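(* Let $f:\mathbb{R}^n\times\mathbb{R}^m\to\mathbb{R}$ and $g:\mathbb{R}^m\to\mathbb{R}^p$ be twice continuously differentiable, $Y:=\{y\in\mathbb{R}^m\mid g(y)\le0\}$, $\varphi(x):=\min_{y\in Y}f(x,y)$ and $S(x):=\arg\min_{y\in Y}f(x,y)$, with $S(x)\ne\emptyset$ for all $x\in\mathbb{R}^n$. Suppose that $S$ is single-valued ($S(x)=\{s(x)\}$) with $s$ Lipschitz continuous around $\bar x\in\mathbb{R}^n$, and let $\bar y:=s(\bar x)$. Then for all $\underline{x}^*\in\mathbb{R}^n$, $$\partial^2\varphi(\bar x)(\underline{x}^* )\subseteq\nabla^2_{xx}f(\bar x,\bar y)\underline{x}^*+\partial\big\langle\nabla^2_{xy}f(\bar x,\bar y)\underline{x}^*,\,s\big\rangle(\bar x).$$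
   Context: Notation. $\nabla^2_{xx}f$ is the $n\times n$ Hessian of $f$ in $x$; $\nabla^2_{xy}f$ is the $m\times n$ matrix with entries $\partial^2f/\partial y_i\partial x_j$. Normal cone. For closed $C\subseteq\mathbb{R}^d$ and $\bar z\in C$, $\widehat N_C(\bar z):=\{v\mid \langle v,z-\bar z\rangle\le o(\|z-\bar z\|)\ \forall z\in C\}$, and $N_C(\bar z):=\{v\mid\exists v_k\to v,\ z_k\to\bar z,\ z_k\in C,\ v_k\in\widehat N_C(z_k)\}$ (Mordukhovich normal cone). Coderivative: $D^*\Psi(\bar x|\bar y)(y^* ):=\{x^*\mid(x^*,-y^* )\in N_{\mathrm{gph}\,\Psi}(\bar x,\bar y)\}$. For a locally Lipschitz real function $\psi$, $\partial\psi(\bar x):=\{\xi\mid(\xi,-1)\in N_{\mathrm{epi}\,\psi}(\bar x,\psi(\bar x))\}$ is the Mordukhovich subdifferential, and $\partial\langle v,s\rangle(\bar x)$ is the Mordukhovich subdifferential of $x\mapsto\sum_iv_is_i(x)$ at $\bar x$. Generalized Hessian: $\partial^2\varphi(\bar x|\underline{x})(\underline{x}^* ):=D^*(\partial\varphi)(\bar x|\underline{x})(\underline{x}^* )$ for $\underline{x}\in\partial\varphi(\bar x)$, where $\partial\varphi$ is the subdifferential of $\varphi$ (Clarke or Mordukhovich). When $\partial\varphi(\bar x)$ is a singleton $\{\underline{x}\}$ (here $\underline{x}=\nabla_xf(\bar x,\bar y)$), one writes $\partial^2\varphi(\bar x)(\underline{x}^* )$ for $\partial^2\varphi(\bar x|\underline{x})(\underline{x}^*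 )$. *)

theory Defs
  imports "HOL-Analysis.Analysis"
begin

definition twice_continuously_differentiable ::
    "('a::real_normed_vector \<Rightarrow> 'b::real_normed_vector) \<Rightarrow> bool" where
  "twice_continuously_differentiable f \<longleftrightarrow>
     (\<exists>f' :: 'a \<Rightarrow> 'a \<Rightarrow>\<^sub>L 'b. \<exists>f'' :: 'a \<Rightarrow> 'a \<Rightarrow>\<^sub>L ('a \<Rightarrow>\<^sub>L 'b).
        (\<forall>x. (f has_derivative blinfun_apply (f' x)) (at x)) \<and>
        (\<forall>x. (f' has_derivative blinfun_apply (f'' x)) (at x)) \<and>
        continuous_on UNIV f'')"

definition partial_deriv :: "'n \<Rightarrow> (real^'n \<Rightarrow> real) \<Rightarrow> real^'n \<Rightarrow> real" where
  "partial_deriv i h x = deriv (\<lambda>t. h (x + t *\<^sub>R axis i 1)) 0"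

definition grad_x :: "((real^'n) \<times> (real^'m) \<Rightarrow> real) \<Rightarrow> real^'n \<Rightarrow> real^'m \<Rightarrow> real^'n" where
  "grad_x f x y = (\<chi> j. partial_deriv j (\<lambda>x'. f (x', y)) x)"

definition hess_xx :: "((real^'n) \<times> (real^'m) \<Rightarrow> real) \<Rightarrow> real^'n \<Rightarrow> real^'m \<Rightarrow> real^'n^'n" where
  "hess_xx f x y =
     (\<chi> i j. partial_deriv i (\<lambda>x''. partial_deriv j (\<lambda>x'. f (x', y)) x'') x)"

text \<open>The \<open>m \<times> n\<close> matrix with \<open>(i, j)\<close> entry \<open>\<partial>\<^sup>2f/\<partial>y\<^sub>i\<partial>x\<^sub>j\<close>: the row
  index belongs to \<open>y\<close>, the column index to \<open>x\<close>.\<close>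

definition hess_xy :: "((real^'n) \<times> (real^'m) \<Rightarrow> real) \<Rightarrow> real^'n \<Rightarrow> real^'m \<Rightarrow> real^'n^'m" where
  "hess_xy f x y =
     (\<chi> i j. partial_deriv i (\<lambda>y'. partial_deriv j (\<lambda>x'. f (x', y')) x) y)"

text \<open>The condition \<open>\<langle>v, z' - z\<rangle> \<le> o(\<parallel>z' - z\<parallel>)\<close> for \<open>z' \<in> C\<close> is one-sided, so it is
  spelled out with \<open>\<epsilon>\<close>. Both normal cones are empty at points outside \<open>C\<close>.\<close>

definition regular_normal_cone :: "'a::real_inner set \<Rightarrow> 'a \<Rightarrow> 'a set" where
  "regular_normal_cone C z =
     {v. z \<in> C \<and>
         (\<forall>\<epsilon>>0. \<forall>\<^sub>F z' in at z within C. inner v (z' - z) \<le> \<epsilon> * norm (z' - z))}"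

definition normal_cone :: "'a::real_inner set \<Rightarrow> 'a \<Rightarrow> 'a set" where
  "normal_cone C z =
     {v. z \<in> C \<and>
         (\<exists>vs zs. vs \<longlonglongrightarrow> v \<and> zs \<longlonglongrightarrow> z \<and>
            (\<forall>k::nat. zs k \<in> C \<and> vs k \<in> regular_normal_cone C (zs k)))}"

definition graph :: "('a \<Rightarrow> 'b set) \<Rightarrow> ('a \<times> 'b) set" where
  "graph \<Psi> = {(x, y). y \<in> \<Psi> x}"

definition coderivative ::
    "('a::real_inner \<Rightarrow> 'b::real_inner set) \<Rightarrow> 'a \<Rightarrow> 'b \<Rightarrow> 'b \<Rightarrow> 'a set" where
  "coderivative \<Psi> x y y' = {x'. (x', - y') \<in> normal_cone (graph \<Psi>) (x, y)}"

definition mordukhovich_subdifferential :: "('a::real_inner \<Rightarrow> real) \<Rightarrow> 'a \<Rightarrow> 'a set" where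
  "mordukhovich_subdifferential \<psi> x =
     {\<xi>. (\<xi>, -1) \<in> normal_cone (epigraph UNIV \<psi>) (x, \<psi> x)}"

text \<open>Clarke's generalized directional derivative: the upper limit of
  \<open>(\<psi>(x' + t d) - \<psi>(x')) / t\<close> as \<open>x' \<rightarrow> x\<close> (with \<open>x' = x\<close> allowed) and \<open>t \<down> 0\<close>.
  It is taken in the extended reals so that it exists for every \<open>\<psi>\<close>; it is finite
  when \<open>\<psi>\<close> is Lipschitz around \<open>x\<close>.\<close>

definition clarke_dir_deriv :: "('a::real_inner \<Rightarrow> real) \<Rightarrow> 'a \<Rightarrow> 'a \<Rightarrow> ereal" where
  "clarke_dir_deriv \<psi> x d =
     Limsup (nhds x \<times>\<^sub>F at_right 0) (\<lambda>(x', t). ereal ((\<psi> (x' + t *\<^sub>R d) - \<psi> x') / t))"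

definition clarke_subdifferential :: "('a::real_inner \<Rightarrow> real) \<Rightarrow> 'a \<Rightarrow> 'a set" where
  "clarke_subdifferential \<psi> x = {\<xi>. \<forall>d. ereal (inner \<xi> d) \<le> clarke_dir_deriv \<psi> x d}"

text \<open>The generalized Hessian relative to a subdifferential operator \<open>sd\<close>
  (Mordukhovich's or Clarke's).\<close>

definition generalized_hessian ::
    "(('a::real_inner \<Rightarrow> real) \<Rightarrow> 'a \<Rightarrow> 'a set) \<Rightarrow> ('a \<Rightarrow> real) \<Rightarrow> 'a \<Rightarrow> 'a \<Rightarrow> 'a \<Rightarrow> 'a set" where
  "generalized_hessian sd \<phi> x v u = coderivative (sd \<phi>) x v u"

text \<open>The infimum is a minimum wherever \<open>argmin_set\<close> is nonempty.\<close>

definition value_function :: "('a \<times> 'b \<Rightarrow> real) \<Rightarrow> 'b set \<Rightarrow> 'a \<Rightarrow> real" where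
  "value_function f Y x = (INF y\<in>Y. f (x, y))"

definition argmin_set :: "('a \<times> 'b \<Rightarrow> real) \<Rightarrow> 'b set \<Rightarrow> 'a \<Rightarrow> 'b set" where
  "argmin_set f Y x = {y. is_arg_min (\<lambda>y. f (x, y)) (\<lambda>y. y \<in> Y) y}"

end

theory Submission
  imports Defs
begin

text \<open>
  Near \<open>xbar\<close> Danskin's envelope argument shows that \<open>\<phi>\<close> is \<open>C\<^sup>1\<close> with gradient
  \<open>G(x) = \<nabla>\<^sub>xf(x, s(x))\<close>, so both subdifferentials reduce to \<open>{G(x)}\<close> and the graph of
  \<open>\<partial>\<phi>\<close> is locally the graph of the Lipschitz map \<open>G\<close>. A regular normal \<open>(v, -u')\<close> to it at a
  nearby point \<open>x\<close>, combined with strict differentiability of \<open>f'\<close> at \<open>(xbar, ybar)\<close>, makes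
  \<open>v - \<nabla>\<^sup>2\<^sub>x\<^sub>xf u\<close> a regular subgradient at \<open>x\<close> of \<open>\<psi> = \<langle>\<nabla>\<^sup>2\<^sub>x\<^sub>yf u, s\<rangle>\<close> up to an
  error \<open>\<epsilon> \<parallel>z - x\<parallel>\<close>. Replacing this error by a quadratic penalty and minimising over a small ball
  gives an exact regular subgradient at a nearby point, and \<open>\<epsilon> \<rightarrow> 0\<close> gives the inclusion.
\<close>

section \<open>Strict differentiability and a one-sided first-order test\<close>

text \<open>The mean value inequality is applied to \<open>F\<close> minus the linear map
  \<open>F' x\<close>; its derivative \<open>F' z - F' x\<close> is small near \<open>x\<close> by
  continuity. Leaving both \<open>a\<close> and \<open>b\<close> free is essential: later increments
  are based at points other than \<open>x\<close>.\<close>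

lemma C1_imp_strict_derivative:
  fixes F :: "'a::real_normed_vector \<Rightarrow> 'b::real_normed_vector" and F' :: "'a \<Rightarrow> 'a \<Rightarrow>\<^sub>L 'b"
  assumes U: "open U" "x \<in> U"
    and der: "\<And>z. z \<in> U \<Longrightarrow> (F has_derivative blinfun_apply (F' z)) (at z)"
    and cont: "isCont F' x" and e: "e > 0"
  obtains d where "d > 0" "ball x d \<subseteq> U"
    "\<And>a b. a \<in> ball x d \<Longrightarrow> b \<in> ball x d \<Longrightarrow>
       norm (F b - F a - blinfun_apply (F' x) (b - a)) \<le> e * norm (b - a)"
proof -
  obtain d1 where d1: "d1 > 0" "ball x d1 \<subseteq> U"
    using U open_contains_ball by blast
  obtain d2 where d2: "d2 > 0" "\<And>z. dist z x < d2 \<Longrightarrow> dist (F' z) (F' x) < e"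
    using cont e unfolding continuous_at_eps_delta by blast
  define d where "d = min d1 d2"
  have sub: "ball x d \<subseteq> U" using d1 by (auto simp: d_def)
  show thesis
  proof (rule that)
    show "d > 0" using d1 d2 by (simp add: d_def)
    show "ball x d \<subseteq> U" by fact
    fix a b assume ab: "a \<in> ball x d" "b \<in> ball x d"
    have "norm ((F b - blinfun_apply (F' x) b) - (F a - blinfun_apply (F' x) a)) \<le> e * norm (b - a)"
    proof (rule differentiable_bound[of "ball x d" _ "\<lambda>z h. blinfun_apply (F' z - F' x) h"])
      show "convex (ball x d)" by simp
      fix z assume z: "z \<in> ball x d"
      have "(F has_derivative blinfun_apply (F' z)) (at z within ball x d)"
        using der z sub has_derivative_at_withinI by blast
      then show "((\<lambda>z. F z - blinfun_apply (F' x) z) has_derivative (\<lambda>h. blinfun_apply (F' z - F' x) h))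
             (at z within ball x d)"
        by (auto intro!: derivative_eq_intros simp: blinfun.diff_left)
      have "dist z x < d2" using z by (simp add: d_def dist_commute)
      then show "onorm (\<lambda>h. blinfun_apply (F' z - F' x) h) \<le> e"
        using d2(2)[of z] by (simp add: dist_norm norm_blinfun.rep_eq)
    qed (use ab in auto)
    then show "norm (F b - F a - blinfun_apply (F' x) (b - a)) \<le> e * norm (b - a)"
      by (simp add: blinfun.diff_right algebra_simps)
  qed
qed

text \<open>A one-sided bound suffices because the direction is free: moving from \<open>x\<close>
  along \<open>v\<close> itself with \<open>e = norm v / 2\<close> contradicts
  \<open>v \<noteq> 0\<close>.\<close>

lemma vector_eq_of_inner_le_small:
  fixes v :: "'a::real_inner"
  assumes "\<And>e. e > 0 \<Longrightarrow> \<forall>\<^sub>F z in at x. inner v (z - x) \<le> e * norm (z - x)"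
  shows "v = 0"
proof (rule ccontr)
  assume v: "v \<noteq> 0"
  then have "norm v / 2 > 0" by simp
  from assms[OF this] obtain d where d: "d > 0"
    "\<And>z. z \<noteq> x \<Longrightarrow> dist z x < d \<Longrightarrow> inner v (z - x) \<le> norm v / 2 * norm (z - x)"
    unfolding eventually_at by auto
  define t where "t = d / (2 * norm v)"
  have t: "t > 0" using d v by (simp add: t_def)
  have "t * norm v < d" using d v by (simp add: t_def)
  then have "inner v (t *\<^sub>R v) \<le> norm v / 2 * norm (t *\<^sub>R v)"
    using d(2)[of "x + t *\<^sub>R v"] t v by (simp add: dist_norm)
  then have "t * (norm v * norm v) \<le> t * (norm v * norm v) / 2"
    using t by (simp add: dot_square_norm power2_eq_square algebra_simps)
  moreover have "t * (norm v * norm v) > 0" using t v by simp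
  ultimately show False by linarith
qed

section \<open>Regular normals to epigraphs\<close>

text \<open>Only points on the graph have to be controlled: raising the height lowers the inner
  product through the component \<open>-1\<close>, and the distance in the product dominates that of
  the first components.\<close>

lemma regular_subgradient_imp_regular_normal:
  fixes \<psi> :: "'a::real_inner \<Rightarrow> real"
  assumes "\<And>e. e > 0 \<Longrightarrow> \<forall>\<^sub>F z in at y. inner \<xi> (z - y) \<le> \<psi> z - \<psi> y + e * norm (z - y)"
  shows "(\<xi>, -1) \<in> regular_normal_cone (epigraph UNIV \<psi>) (y, \<psi> y)"
  unfolding regular_normal_cone_def
proof (intro CollectI conjI allI impI)
  show "(y, \<psi> y) \<in> epigraph UNIV \<psi>" by (simp add: epigraph_def)
  fix e :: real assume e: "e > 0"
  obtain d where d: "d > 0"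
    "\<And>z. z \<noteq> y \<Longrightarrow> dist z y < d \<Longrightarrow> inner \<xi> (z - y) \<le> \<psi> z - \<psi> y + e * norm (z - y)"
    using assms[OF e] unfolding eventually_at by auto
  show "\<forall>\<^sub>F z' in at (y, \<psi> y) within epigraph UNIV \<psi>.
      inner (\<xi>, -1) (z' - (y, \<psi> y)) \<le> e * norm (z' - (y, \<psi> y))"
    unfolding eventually_at
  proof (intro exI[of _ d] conjI ballI impI)
    fix p assume p: "p \<in> epigraph UNIV \<psi>" "p \<noteq> (y, \<psi> y) \<and> dist p (y, \<psi> y) < d"
    obtain z t where zt: "p = (z, t)" by (cases p)
    have t: "t \<ge> \<psi> z" using p zt by (simp add: epigraph_def)
    have "dist z y < d" using p zt dist_fst_le[of p "(y, \<psi> y)"] by simp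
    then have "inner \<xi> (z - y) \<le> \<psi> z - \<psi> y + e * norm (z - y)"
      \<comment> \<open>A point \<open>p\<close> straight above the base point has
        \<open>z = y\<close>, which the punctured bound omits; there the inequality is
        trivial.\<close>
      using d(2)[of z] by (cases "z = y") auto
    moreover have "e * norm (z - y) \<le> e * norm (p - (y, \<psi> y))"
      using e dist_fst_le[of p "(y, \<psi> y)"] by (simp add: zt dist_norm)
    ultimately show "inner (\<xi>, -1) (p - (y, \<psi> y)) \<le> e * norm (p - (y, \<psi> y))"
      using t by (simp add: zt)
  qed (use d in auto)
qed

lemma regular_normal_imp_mordukhovich_subgradient:
  assumes "(\<xi>, -1) \<in> regular_normal_cone (epigraph UNIV \<psi>) (y, \<psi> y)"
  shows "\<xi> \<in> mordukhovich_subdifferential \<psi> y"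
proof -
  have "(y, \<psi> y) \<in> epigraph UNIV \<psi>" by (simp add: epigraph_def)
  then show ?thesis
    unfolding mordukhovich_subdifferential_def normal_cone_def mem_Collect_eq using assms
    by (intro conjI exI[of _ "\<lambda>_. (\<xi>, -1)"] exI[of _ "\<lambda>_. (y, \<psi> y)"]) auto
qed

text \<open>The normal is tested along a curve parallel to the graph. Expanding
  \<open>\<phi>\<close> to first order bounds \<open>inner (v + b *\<^sub>R g) (z - x)\<close> by a
  small multiple of \<open>norm (z - x)\<close> in all directions, so this vector vanishes.\<close>

lemma regular_normal_epigraph_differentiable:
  fixes \<phi> :: "'a::real_inner \<Rightarrow> real"
  assumes n: "(v, b) \<in> regular_normal_cone (epigraph UNIV \<phi>) (x, t)"
    and der: "(\<phi> has_derivative (\<lambda>h. inner g h)) (at x)"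
  shows "v = - b *\<^sub>R g"
proof -
  have t: "\<phi> x \<le> t"
    using n by (simp add: regular_normal_cone_def epigraph_def)
  \<comment> \<open>Translating the graph vertically by \<open>t - \<phi> x \<ge> 0\<close> stays inside the epigraph, so it is not
    necessary to show first that \<open>t = \<phi> x\<close>.\<close>
  define q where "q z = (z, t + (\<phi> z - \<phi> x))" for z
  have q_epi: "q z \<in> epigraph UNIV \<phi>" for z using t by (simp add: q_def epigraph_def)
  have contphi: "isCont \<phi> x" using der has_derivative_continuous by blast
  have "(q \<longlongrightarrow> (x, t + (\<phi> x - \<phi> x))) (at x)"
    unfolding q_def using contphi unfolding isCont_def by (intro tendsto_intros) auto
  then have lim: "filterlim q (at (x, t) within epigraph UNIV \<phi>) (at x)"
    unfolding filterlim_at using q_epi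
    by (auto simp: eventually_at_filter) (simp add: q_def)
  have "v + b *\<^sub>R g = 0"
  proof (rule vector_eq_of_inner_le_small[where x = x])
    fix e :: real assume e: "e > 0"
    \<comment> \<open>\<open>K\<close> collects the error factors: \<open>norm g + 2\<close> bounds
      the length of the increment of \<open>q\<close> relative to \<open>norm (z - x)\<close>, and
      \<open>\<bar>b\<bar>\<close> is the price of replacing the increment of \<open>\<phi>\<close>
      by its linear part. The cap \<open>e1 \<le> 1\<close> keeps the first factor independent of
      \<open>e\<close>.\<close>
    define K where "K = 2 + norm g + \<bar>b\<bar>"
    have K: "K > 0" by (simp add: K_def add_pos_nonneg)
    define e1 where "e1 = min 1 (e / K)"
    have e1: "e1 > 0" "e1 \<le> 1" "e1 * K \<le> e"
      using e K by (auto simp: e1_def min_def field_simps)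
    have 1: "\<forall>\<^sub>F z in at x. inner (v, b) (q z - (x, t)) \<le> e1 * norm (q z - (x, t))"
      using n e1 lim unfolding regular_normal_cone_def filterlim_iff by blast
    have 2: "\<forall>\<^sub>F z in at x. norm (\<phi> z - \<phi> x - inner g (z - x)) \<le> e1 * norm (z - x)"
      using der e1 unfolding has_derivative_at_alt eventually_at by (fastforce simp: dist_norm)
    show "\<forall>\<^sub>F z in at x. inner (v + b *\<^sub>R g) (z - x) \<le> e * norm (z - x)"
      using 1 2
    proof eventually_elim
      case (elim z)
      let ?N = "norm (z - x)" and ?D = "\<phi> z - \<phi> x"
      have D: "\<bar>?D - inner g (z - x)\<bar> \<le> e1 * ?N" using elim(2) by simp
      have "\<bar>inner g (z - x)\<bar> \<le> norm g * ?N" by (rule Cauchy_Schwarz_ineq2)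
      moreover have "e1 * ?N \<le> 1 * ?N" using e1 by (intro mult_right_mono) auto
      ultimately have D': "\<bar>?D\<bar> \<le> (norm g + 1) * ?N" using D by (simp add: algebra_simps)
      have "norm (q z - (x, t)) \<le> ?N + \<bar>?D\<bar>"
        using norm_Pair_le[of "z - x" ?D] by (simp add: q_def)
      also have "\<dots> \<le> (norm g + 2) * ?N" using D' by (simp add: algebra_simps)
      finally have "e1 * norm (q z - (x, t)) \<le> e1 * ((norm g + 2) * ?N)"
        using e1 by (intro mult_left_mono) auto
      then have A: "inner v (z - x) + b * ?D \<le> e1 * ((norm g + 2) * ?N)"
        using elim(1) by (simp add: q_def)
      have "b * (inner g (z - x) - ?D) \<le> \<bar>b\<bar> * \<bar>?D - inner g (z - x)\<bar>"
        by (metis abs_ge_self abs_minus_commute abs_mult)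
      also have "\<dots> \<le> \<bar>b\<bar> * (e1 * ?N)" using D by (intro mult_left_mono) auto
      finally have "inner (v + b *\<^sub>R g) (z - x) \<le> e1 * K * ?N"
        using A by (simp add: K_def inner_add_left algebra_simps)
      also have "\<dots> \<le> e * ?N" using e1 by (intro mult_right_mono) auto
      finally show ?case .
    qed
  qed
  then show ?thesis by (simp add: eq_neg_iff_add_eq_0)
qed

section \<open>Subdifferentials of continuously differentiable functions\<close>

text \<open>The derivative is itself a regular subgradient. Conversely, regular normals at nearby
  epigraph points, at whatever height, are multiples of \<open>(G z, -1)\<close>; continuity of
  \<open>G\<close> carries this to the limit, where the multiplier tends to 1.\<close>

lemma mordukhovich_subdifferential_C1:
  fixes \<phi> :: "'a::real_inner \<Rightarrow> real"
  assumes U: "open U" "x \<in> U"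
    and der: "\<And>z. z \<in> U \<Longrightarrow> (\<phi> has_derivative (\<lambda>h. inner (G z) h)) (at z)"
    and cont: "isCont G x"
  shows "mordukhovich_subdifferential \<phi> x = {G x}"
proof (intro equalityI subsetI)
  fix \<xi> assume "\<xi> \<in> {G x}"
  then have \<xi>: "\<xi> = G x" by simp
  show "\<xi> \<in> mordukhovich_subdifferential \<phi> x"
  proof (rule regular_normal_imp_mordukhovich_subgradient, rule regular_subgradient_imp_regular_normal)
    fix e :: real assume "e > 0"
    then have "\<forall>\<^sub>F z in at x. norm (\<phi> z - \<phi> x - inner (G x) (z - x)) \<le> e * norm (z - x)"
      using der[OF U(2)] unfolding has_derivative_at_alt eventually_at by (fastforce simp: dist_norm)
    then show "\<forall>\<^sub>F z in at x. inner \<xi> (z - x) \<le> \<phi> z - \<phi> x + e * norm (z - x)"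
      by eventually_elim (auto simp: \<xi> abs_le_iff)
  qed
next
  fix \<xi> assume "\<xi> \<in> mordukhovich_subdifferential \<phi> x"
  then obtain vs zs where lim: "vs \<longlonglongrightarrow> (\<xi>, -1)" "zs \<longlonglongrightarrow> (x, \<phi> x)"
    and reg: "\<And>k::nat. vs k \<in> regular_normal_cone (epigraph UNIV \<phi>) (zs k)"
    unfolding mordukhovich_subdifferential_def normal_cone_def by blast
  have zs1: "(\<lambda>k. fst (zs k)) \<longlonglongrightarrow> x" using tendsto_fst[OF lim(2)] by simp
  have "\<forall>\<^sub>F k in sequentially. fst (zs k) \<in> U"
    using zs1 U topological_tendstoD by blast
  then have "\<forall>\<^sub>F k in sequentially. - snd (vs k) *\<^sub>R G (fst (zs k)) = fst (vs k)"
  proof eventually_elim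
    case (elim k)
    show ?case
      using regular_normal_epigraph_differentiable[of "fst (vs k)" "snd (vs k)" \<phi> "fst (zs k)" "snd (zs k)"]
        reg[of k] der[OF elim] by simp
  qed
  moreover have "(\<lambda>k. - snd (vs k) *\<^sub>R G (fst (zs k))) \<longlonglongrightarrow> - snd (\<xi>, -1::real) *\<^sub>R G x"
    using cont zs1 lim(1) by (intro tendsto_intros isCont_tendsto_compose[OF cont]) auto
  ultimately have "(\<lambda>k. fst (vs k)) \<longlonglongrightarrow> G x"
    using Lim_transform_eventually by fastforce
  moreover have "(\<lambda>k. fst (vs k)) \<longlonglongrightarrow> \<xi>" using tendsto_fst[OF lim(1)] by simp
  ultimately show "\<xi> \<in> {G x}" using LIMSEQ_unique by blast
qed

text \<open>Strict differentiability is uniform in the moving base point \<open>x'\<close>, so the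
  upper limit is a genuine limit, linear in \<open>d\<close>. Testing a subgradient in the direction
  \<open>\<xi> - G x\<close> then forces equality.\<close>

lemma clarke_subdifferential_C1:
  fixes \<phi> :: "'a::real_inner \<Rightarrow> real"
  assumes U: "open U" "x \<in> U"
    and der: "\<And>z. z \<in> U \<Longrightarrow> (\<phi> has_derivative (\<lambda>h. inner (G z) h)) (at z)"
    and cont: "isCont G x"
  shows "clarke_subdifferential \<phi> x = {G x}"
proof -
  have dd: "clarke_dir_deriv \<phi> x d = ereal (inner (G x) d)" for d
  proof -
    have "((\<lambda>(x', t). (\<phi> (x' + t *\<^sub>R d) - \<phi> x') / t) \<longlongrightarrow> inner (G x) d) (nhds x \<times>\<^sub>F at_right (0::real))"
      unfolding tendsto_iff
    proof (intro allI impI)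
      fix e :: real assume e: "e > 0"
      \<comment> \<open>The added 1 covers \<open>d = 0\<close> and makes \<open>e1 * norm d\<close>
        strictly smaller than \<open>e\<close>.\<close>
      define e1 where "e1 = e / (norm d + 1)"
      have nd: "norm d + 1 > 0" by (simp add: add_nonneg_pos)
      have e1: "e1 > 0" using e nd by (simp add: e1_def)
      have e1d: "e1 * norm d < e" using e nd by (simp add: e1_def field_simps)
      obtain r where r: "r > 0" "\<And>a b. a \<in> ball x r \<Longrightarrow> b \<in> ball x r \<Longrightarrow>
          norm (\<phi> b - \<phi> a - blinfun_apply (blinfun_inner_right (G x)) (b - a)) \<le> e1 * norm (b - a)"
      proof (rule C1_imp_strict_derivative[of U x \<phi> "\<lambda>z. blinfun_inner_right (G z)" e1])
        show "isCont (\<lambda>z. blinfun_inner_right (G z)) x"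
          using cont by (intro continuous_intros)
      qed (use U der e1 in auto)
      have L: "((\<lambda>p. fst p + snd p *\<^sub>R d) \<longlongrightarrow> x + 0 *\<^sub>R d) (nhds x \<times>\<^sub>F at_right (0::real))"
        by (intro tendsto_intros filterlim_fst filterlim_compose[OF _ filterlim_snd, of "\<lambda>x. x"])
      have F1: "\<forall>\<^sub>F p in nhds x \<times>\<^sub>F at_right (0::real). fst p + snd p *\<^sub>R d \<in> ball x r"
        using topological_tendstoD[OF L, of "ball x r"] r by simp
      have F2: "\<forall>\<^sub>F p in nhds x \<times>\<^sub>F at_right (0::real). fst p \<in> ball x r"
        using topological_tendstoD[OF filterlim_fst, of "ball x r" x] r by simp
      have F3: "\<forall>\<^sub>F p in nhds x \<times>\<^sub>F at_right (0::real). snd p > 0"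
        by (rule eventually_compose_filterlim[OF _ filterlim_snd])
           (simp add: eventually_at_right_less)
      show "\<forall>\<^sub>F p in nhds x \<times>\<^sub>F at_right (0::real).
          dist (case p of (x', t) \<Rightarrow> (\<phi> (x' + t *\<^sub>R d) - \<phi> x') / t) (inner (G x) d) < e"
        using F1 F2 F3
      proof eventually_elim
        case (elim p)
        obtain a t where p: "p = (a, t)" by (cases p)
        have t: "t > 0" using elim p by simp
        have "\<bar>\<phi> (a + t *\<^sub>R d) - \<phi> a - t * inner (G x) d\<bar> \<le> e1 * (t * norm d)"
          using r(2)[of a "a + t *\<^sub>R d"] elim p t by simp
        then have "\<bar>(\<phi> (a + t *\<^sub>R d) - \<phi> a - t * inner (G x) d) / t\<bar> \<le> e1 * norm d"
          using t by (simp add: pos_divide_le_eq mult_ac)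
        moreover have "(\<phi> (a + t *\<^sub>R d) - \<phi> a - t * inner (G x) d) / t
            = (\<phi> (a + t *\<^sub>R d) - \<phi> a) / t - inner (G x) d" using t by (simp add: field_simps)
        ultimately show ?case using e1d p by (simp add: dist_real_def)
      qed
    qed
    then have "((\<lambda>p. ereal (case p of (x', t) \<Rightarrow> (\<phi> (x' + t *\<^sub>R d) - \<phi> x') / t))
        \<longlongrightarrow> ereal (inner (G x) d)) (nhds x \<times>\<^sub>F at_right (0::real))"
      by (rule tendsto_ereal)
    then have "((\<lambda>(x', t). ereal ((\<phi> (x' + t *\<^sub>R d) - \<phi> x') / t))
        \<longlongrightarrow> ereal (inner (G x) d)) (nhds x \<times>\<^sub>F at_right (0::real))"
      by (simp add: case_prod_unfold)
    then show ?thesis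
      unfolding clarke_dir_deriv_def
      by (intro lim_imp_Limsup) (auto simp: prod_filter_eq_bot)
  qed
  show ?thesis
  proof (intro equalityI subsetI)
    fix \<xi> assume "\<xi> \<in> clarke_subdifferential \<phi> x"
    then have "inner \<xi> d \<le> inner (G x) d" for d
      by (simp add: clarke_subdifferential_def dd)
    from this[of "\<xi> - G x"] have "inner (\<xi> - G x) (\<xi> - G x) \<le> 0" by (simp add: inner_diff_left)
    then have "\<xi> - G x = 0" using inner_ge_zero inner_eq_zero_iff antisym by metis
    then show "\<xi> \<in> {G x}" by simp
  qed (simp add: clarke_subdifferential_def dd)
qed

section \<open>From approximate regular subgradients to limiting subgradients\<close>

text \<open>The error \<open>e * norm (z - x)\<close> is traded for a small move of the base point
  and of the slope. At an interior minimiser of the penalised function, the slope of the penalty is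
  absorbed into \<open>\<xi>\<close> and only a quadratic remainder is left.\<close>

lemma regular_subgradient_near_approximate:
  fixes \<psi> :: "'a::euclidean_space \<Rightarrow> real"
  assumes r: "r > 0" and e: "e > 0" and cont: "continuous_on (cball x r) \<psi>"
    and approx: "\<And>z. z \<in> cball x r \<Longrightarrow> inner w (z - x) \<le> \<psi> z - \<psi> x + e * norm (z - x)"
  obtains y \<xi> where "dist y x < r" "norm (\<xi> - w) \<le> 2 * e"
    "(\<xi>, -1) \<in> regular_normal_cone (epigraph UNIV \<psi>) (y, \<psi> y)"
proof -
  \<comment> \<open>Comparing the minimiser \<open>y\<close> with \<open>x\<close> yields
    \<open>C * norm (y - x) \<le> e\<close>. This choice of \<open>C\<close> therefore puts
    \<open>y\<close> within \<open>r / 2\<close> of \<open>x\<close>, and the change of slope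
    \<open>2 * C * norm (y - x)\<close> is at most \<open>2 * e\<close>.\<close>
  define C where "C = 2 * e / r"
  have C: "C > 0" using e r by (simp add: C_def)
  define F where "F z = \<psi> z - inner w z + C * (norm (z - x))\<^sup>2" for z
  have "continuous_on (cball x r) F"
    unfolding F_def by (intro continuous_intros cont)
  then obtain y where y: "y \<in> cball x r" "\<And>z. z \<in> cball x r \<Longrightarrow> F y \<le> F z"
    using continuous_attains_inf[of "cball x r" F] r by auto
  have "C * (norm (y - x))\<^sup>2 \<le> e * norm (y - x)"
    using y(2)[of x] approx[OF y(1)] r by (simp add: F_def inner_diff_right)
  then have Cy: "C * norm (y - x) \<le> e"
    using e by (cases "y = x") (auto simp: power2_eq_square mult.assoc[symmetric] mult_le_cancel_right)
  have "norm (y - x) \<le> r / 2" using Cy e r by (simp add: C_def field_simps)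
  then have yr: "dist y x < r" using r by (simp add: dist_norm)
  define \<xi> where "\<xi> = w - (2 * C) *\<^sub>R (y - x)"
  have main: "inner \<xi> (z - y) \<le> \<psi> z - \<psi> y + C * (norm (z - y))\<^sup>2" if "z \<in> cball x r" for z
  proof -
    \<comment> \<open>The penalty is recentred at \<open>y\<close>; its cross term is exactly the
      correction in \<open>\<xi>\<close>.\<close>
    have sq: "(norm (z - x))\<^sup>2 = (norm (y - x))\<^sup>2 + 2 * inner (y - x) (z - y) + (norm (z - y))\<^sup>2"
      by (simp add: power2_norm_eq_inner inner_diff_left inner_diff_right inner_commute)
    have "C * (norm (z - x))\<^sup>2 =
        C * (norm (y - x))\<^sup>2 + 2 * C * inner (y - x) (z - y) + C * (norm (z - y))\<^sup>2"
      unfolding sq by algebra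
    then show ?thesis
      using y(2)[OF that] unfolding F_def \<xi>_def inner_diff_left[of w] inner_scaleR_left inner_diff_right[of w]
      by linarith
  qed
  show thesis
  proof (rule that)
    show "dist y x < r" by fact
    show "norm (\<xi> - w) \<le> 2 * e" using Cy C by (simp add: \<xi>_def)
    show "(\<xi>, -1) \<in> regular_normal_cone (epigraph UNIV \<psi>) (y, \<psi> y)"
    proof (rule regular_subgradient_imp_regular_normal)
      fix \<epsilon> :: real assume \<epsilon>: "\<epsilon> > 0"
      have "\<forall>\<^sub>F z in at y. z \<in> ball x r"
        using yr by (intro eventually_at_in_open') (auto simp: dist_commute)
      moreover have "\<forall>\<^sub>F z in at y. dist z y < \<epsilon> / C"
        unfolding eventually_at using \<epsilon> C by (intro exI[of _ "\<epsilon> / C"]) auto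
      ultimately show "\<forall>\<^sub>F z in at y. inner \<xi> (z - y) \<le> \<psi> z - \<psi> y + \<epsilon> * norm (z - y)"
      proof eventually_elim
        case (elim z)
        have "C * norm (z - y) \<le> \<epsilon>" using elim(2) C by (simp add: dist_norm field_simps)
        then have "C * (norm (z - y))\<^sup>2 \<le> \<epsilon> * norm (z - y)"
          by (simp add: power2_eq_square mult.assoc[symmetric] mult_right_mono)
        then show ?case using main[of z] elim(1) by simp
      qed
    qed
  qed
qed

text \<open>Each approximate subgradient has an exact regular one nearby; letting the tolerance tend
  to 0 produces the sequences that the limiting normal cone requires. Continuity of
  \<open>\<psi>\<close> makes the heights converge too.\<close>

lemma mordukhovich_subgradientI_approximate:
  fixes \<psi> :: "'a::euclidean_space \<Rightarrow> real"
  assumes U: "open U" "x0 \<in> U" and cont: "continuous_on U \<psi>"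
    and approx: "\<And>e. e > 0 \<Longrightarrow> \<exists>x w'. dist x x0 < e \<and> norm (w' - w) < e \<and>
          (\<forall>\<^sub>F z in at x. inner w' (z - x) \<le> \<psi> z - \<psi> x + e * norm (z - x))"
  shows "w \<in> mordukhovich_subdifferential \<psi> x0"
proof -
  obtain \<delta> where \<delta>: "\<delta> > 0" "ball x0 \<delta> \<subseteq> U" using U open_contains_ball by blast
  \<comment> \<open>The factors come from the triangle inequality: \<open>y\<close> is within
    \<open>e\<close> of \<open>x\<close>, which is within \<open>e\<close> of \<open>x0\<close>;
    \<open>\<xi>\<close> is within \<open>2 * e\<close> of \<open>w'\<close>, which is within
    \<open>e\<close> of \<open>w\<close>. The bound \<open>2 * e \<le> \<delta>\<close> keeps the
    ball of minimisation inside \<open>U\<close>.\<close>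
  have step: "\<exists>y \<xi>. dist y x0 < 2 * e \<and> norm (\<xi> - w) < 3 * e \<and>
      (\<xi>, -1) \<in> regular_normal_cone (epigraph UNIV \<psi>) (y, \<psi> y)" if e: "0 < e" "2 * e \<le> \<delta>" for e
  proof -
    obtain x w' where xw: "dist x x0 < e" "norm (w' - w) < e"
      "\<forall>\<^sub>F z in at x. inner w' (z - x) \<le> \<psi> z - \<psi> x + e * norm (z - x)"
      using approx[OF e(1)] by blast
    obtain d where d: "d > 0"
      "\<And>z. z \<noteq> x \<Longrightarrow> dist z x < d \<Longrightarrow> inner w' (z - x) \<le> \<psi> z - \<psi> x + e * norm (z - x)"
      using xw(3) unfolding eventually_at by auto
    define r where "r = min (d / 2) e"
    have r: "r > 0" "r \<le> e" "r < d" using d e by (auto simp: r_def)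
    have sub: "cball x r \<subseteq> U"
    proof
      fix z assume "z \<in> cball x r"
      then have "dist x0 z < \<delta>"
        using xw(1) r e dist_triangle[of x0 z x] by (simp add: dist_commute)
      then show "z \<in> U" using \<delta> by auto
    qed
    obtain y \<xi> where "dist y x < r" "norm (\<xi> - w') \<le> 2 * e"
      "(\<xi>, -1) \<in> regular_normal_cone (epigraph UNIV \<psi>) (y, \<psi> y)"
    proof (rule regular_subgradient_near_approximate[OF r(1) e(1)])
      show "continuous_on (cball x r) \<psi>" using cont sub continuous_on_subset by blast
      show "inner w' (z - x) \<le> \<psi> z - \<psi> x + e * norm (z - x)" if "z \<in> cball x r" for z
        using d(2)[of z] that r by (cases "z = x") (auto simp: dist_commute)
    qed
    moreover from this have "dist y x0 < 2 * e"
      using xw(1) r dist_triangle[of y x0 x] by simp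
    moreover have "norm (\<xi> - w) < 3 * e"
      using norm_triangle_ineq[of "\<xi> - w'" "w' - w"] xw(2) calculation(2) by simp
    ultimately show ?thesis by blast
  qed
  define E where "E k = \<delta> / 2 / real (Suc k)" for k
  have "0 < E k" "2 * E k \<le> \<delta>" for k using \<delta> by (auto simp: E_def field_simps)
  then have "\<forall>k. \<exists>y \<xi>. dist y x0 < 2 * E k \<and> norm (\<xi> - w) < 3 * E k \<and>
      (\<xi>, -1) \<in> regular_normal_cone (epigraph UNIV \<psi>) (y, \<psi> y)" using step by blast
  then obtain Y \<Xi> where Y: "\<And>k. dist (Y k) x0 < 2 * E k" and \<Xi>: "\<And>k. norm (\<Xi> k - w) < 3 * E k"
    and reg: "\<And>k. (\<Xi> k, -1) \<in> regular_normal_cone (epigraph UNIV \<psi>) (Y k, \<psi> (Y k))"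
    by metis
  have E0: "E \<longlonglongrightarrow> 0"
    unfolding E_def using LIMSEQ_Suc[OF lim_const_over_n[of "\<delta> / 2"]] by simp
  have Y0: "Y \<longlonglongrightarrow> x0"
    unfolding tendsto_dist_iff[of Y]
    by (rule Lim_null_comparison[of _ "\<lambda>k. 2 * E k"])
       (use Y in \<open>auto intro: less_imp_le always_eventually tendsto_mult_right_zero E0\<close>)
  have \<Xi>0: "\<Xi> \<longlonglongrightarrow> w"
    unfolding tendsto_dist_iff[of \<Xi>] dist_norm
    by (rule Lim_null_comparison[of _ "\<lambda>k. 3 * E k"])
       (use \<Xi> in \<open>auto intro: less_imp_le always_eventually tendsto_mult_right_zero E0\<close>)
  have "isCont \<psi> x0" using cont U continuous_on_eq_continuous_at by blast
  then have "(\<lambda>k. (Y k, \<psi> (Y k))) \<longlonglongrightarrow> (x0, \<psi> x0)"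
    using Y0 by (intro tendsto_Pair isCont_tendsto_compose[of x0 \<psi>])
  moreover have "(\<lambda>k. (\<Xi> k, -1::real)) \<longlonglongrightarrow> (w, -1)" using \<Xi>0 by (intro tendsto_intros)
  moreover have "(z, \<psi> z) \<in> epigraph UNIV \<psi>" for z by (simp add: epigraph_def)
  ultimately show ?thesis
    unfolding mordukhovich_subdifferential_def normal_cone_def mem_Collect_eq
    using reg by (intro conjI exI[of _ "\<lambda>k. (\<Xi> k, -1)"] exI[of _ "\<lambda>k. (Y k, \<psi> (Y k))"]) auto
qed

section \<open>Coordinate gradients and Hessian blocks as derivatives\<close>

lemma linear_eq_inner_axis:
  fixes L :: "real^'n \<Rightarrow> real"
  assumes "linear L"
  shows "inner (\<chi> j. L (axis j 1)) h = L h"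
proof -
  have "L h = L (\<Sum>i\<in>UNIV. h $ i *\<^sub>R axis i 1)"
    using basis_expansion[of h] by (simp add: scalar_mult_eq_scaleR)
  also have "\<dots> = (\<Sum>i\<in>UNIV. h $ i * L (axis i 1))"
    by (simp add: linear_sum[OF assms] linear_scale[OF assms] o_def)
  finally show ?thesis by (simp add: inner_vec_def mult.commute)
qed

lemma partial_deriv_eq:
  assumes "(h has_derivative h') (at x)"
  shows "partial_deriv i h x = h' (axis i 1)"
proof -
  have "((\<lambda>t::real. x + t *\<^sub>R axis i 1) has_derivative (\<lambda>t. t *\<^sub>R axis i 1)) (at 0)"
    by (auto intro!: derivative_eq_intros)
  moreover have "(h has_derivative h') (at (x + 0 *\<^sub>R axis i 1))" using assms by simp
  ultimately have "((\<lambda>t. h (x + t *\<^sub>R axis i 1)) has_derivative (\<lambda>t. h' (t *\<^sub>R axis i 1))) (at 0)"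
    by (rule has_derivative_compose)
  moreover have "linear h'" using assms has_derivative_linear by blast
  ultimately have "((\<lambda>t. h (x + t *\<^sub>R axis i 1)) has_derivative (\<lambda>t. h' (axis i 1) * t)) (at 0)"
    by (simp add: linear_scale mult.commute)
  then show ?thesis
    unfolding partial_deriv_def has_field_derivative_def[symmetric] by (rule DERIV_imp_deriv)
qed

lemma has_derivative_partial_fst:
  assumes "(f has_derivative f') (at (x, y))"
  shows "((\<lambda>x'. f (x', y)) has_derivative (\<lambda>h. f' (h, 0))) (at x)"
proof -
  have "((\<lambda>x'. (x', y)) has_derivative (\<lambda>h. (h, 0))) (at x)"
    by (intro has_derivative_Pair has_derivative_ident has_derivative_const)
  then show ?thesis using assms by (rule has_derivative_compose)
qed

lemma has_derivative_partial_snd: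
  assumes "(f has_derivative f') (at (x, y))"
  shows "((\<lambda>y'. f (x, y')) has_derivative (\<lambda>h. f' (0, h))) (at y)"
proof -
  have "((\<lambda>y'. (x, y')) has_derivative (\<lambda>h. (0, h))) (at y)"
    by (intro has_derivative_Pair has_derivative_ident has_derivative_const)
  then show ?thesis using assms by (rule has_derivative_compose)
qed

lemma inner_grad_x:
  assumes "(f has_derivative blinfun_apply D) (at (x, y))"
  shows "inner (grad_x f x y) h = blinfun_apply D (h, 0)"
proof -
  have "linear (\<lambda>h. blinfun_apply D (h, 0))"
    using has_derivative_linear[OF has_derivative_partial_fst[OF assms]] .
  from linear_eq_inner_axis[OF this, of h] show ?thesis
    by (simp add: grad_x_def partial_deriv_eq[OF has_derivative_partial_fst[OF assms]])
qed

context
  fixes f :: "(real^'n) \<times> (real^'m) \<Rightarrow> real"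
    and f' :: "(real^'n) \<times> (real^'m) \<Rightarrow> ((real^'n) \<times> (real^'m)) \<Rightarrow>\<^sub>L real"
    and f'' :: "(real^'n) \<times> (real^'m) \<Rightarrow> ((real^'n) \<times> (real^'m)) \<Rightarrow>\<^sub>L (((real^'n) \<times> (real^'m)) \<Rightarrow>\<^sub>L real)"
  assumes der1: "\<And>z. (f has_derivative blinfun_apply (f' z)) (at z)"
    and der2: "\<And>z. (f' has_derivative blinfun_apply (f'' z)) (at z)"
begin

lemma grad_component_x: "partial_deriv j (\<lambda>x'. f (x', y)) x = blinfun_apply (f' (x, y)) (axis j 1, 0)"
  by (rule partial_deriv_eq[OF has_derivative_partial_fst[OF der1]])

lemma has_derivative_blinfun_apply_const:
  "((\<lambda>z. blinfun_apply (f' z) c) has_derivative (\<lambda>k. blinfun_apply (blinfun_apply (f'' z) k) c)) (at z)"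
  using der2[of z] by (auto intro!: derivative_eq_intros)

lemma hess_xx_entry:
  "hess_xx f x y $ i $ j = blinfun_apply (blinfun_apply (f'' (x, y)) (axis i 1, 0)) (axis j 1, 0)"
  unfolding hess_xx_def grad_component_x
  by (simp add: partial_deriv_eq[OF has_derivative_partial_fst[OF has_derivative_blinfun_apply_const]])

lemma hess_xy_entry:
  "hess_xy f x y $ i $ j = blinfun_apply (blinfun_apply (f'' (x, y)) (0, axis i 1)) (axis j 1, 0)"
  unfolding hess_xy_def grad_component_x
  by (simp add: partial_deriv_eq[OF has_derivative_partial_snd[OF has_derivative_blinfun_apply_const]])

lemma linear_blinfun_Pair_fst: "linear (\<lambda>u. blinfun_apply B (u, 0))"
  using blinfun.bounded_linear_right[of B]
  by (intro linearI)
     (simp_all flip: blinfun.add_right blinfun.scaleR_right)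

text \<open>The row index is the direction of the outer differentiation, so the product with
  \<open>u\<close> contracts the inner slot of \<open>f''\<close> and \<open>h\<close> enters the
  outer one.\<close>

lemma inner_hess_xx:
  "inner (hess_xx f x y *v u) h = blinfun_apply (blinfun_apply (f'' (x, y)) (h, 0)) (u, 0)"
proof -
  have row: "(hess_xx f x y *v u) $ i = blinfun_apply (blinfun_apply (f'' (x, y)) (axis i 1, 0)) (u, 0)" for i
    using linear_eq_inner_axis[OF linear_blinfun_Pair_fst[of "blinfun_apply (f'' (x, y)) (axis i 1, 0)"], of u]
    by (simp add: matrix_vector_mult_def inner_vec_def hess_xx_entry)
  have "linear (\<lambda>h. blinfun_apply (blinfun_apply (f'' (x, y)) (h, 0)) (u, 0))"
    using has_derivative_linear[OF has_derivative_partial_fst[OF has_derivative_blinfun_apply_const]] .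
  from linear_eq_inner_axis[OF this, of h] show ?thesis
    by (simp flip: row)
qed

lemma inner_hess_xy:
  "inner (hess_xy f x y *v u) k = blinfun_apply (blinfun_apply (f'' (x, y)) (0, k)) (u, 0)"
proof -
  have row: "(hess_xy f x y *v u) $ i = blinfun_apply (blinfun_apply (f'' (x, y)) (0, axis i 1)) (u, 0)" for i
    using linear_eq_inner_axis[OF linear_blinfun_Pair_fst[of "blinfun_apply (f'' (x, y)) (0, axis i 1)"], of u]
    by (simp add: matrix_vector_mult_def inner_vec_def hess_xy_entry)
  have "linear (\<lambda>k. blinfun_apply (blinfun_apply (f'' (x, y)) (0, k)) (u, 0))"
    using has_derivative_linear[OF has_derivative_partial_snd[OF has_derivative_blinfun_apply_const]] .
  from linear_eq_inner_axis[OF this, of k] show ?thesis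
    by (simp flip: row)
qed

text \<open>This is the linearisation of the \<open>u\<close>-component of the partial gradient in
  \<open>x\<close>: the increment \<open>(h, k)\<close> splits into an \<open>x\<close> part and a
  \<open>y\<close> part, which the two Hessian blocks represent.\<close>

lemma second_derivative_eq_hess:
  "blinfun_apply (blinfun_apply (f'' (x, y)) (h, k)) (u, 0)
     = inner (hess_xx f x y *v u) h + inner (hess_xy f x y *v u) k"
proof -
  have "blinfun_apply (f'' (x, y)) (h, k)
      = blinfun_apply (f'' (x, y)) (h, 0) + blinfun_apply (f'' (x, y)) (0, k)"
    by (simp flip: blinfun.add_right)
  then show ?thesis by (simp add: inner_hess_xx inner_hess_xy blinfun.add_left)
qed

end

text \<open>Testing \<open>A - B\<close> on the gradient difference itself gives the bound. It
  transfers continuity and Lipschitz estimates from \<open>f'\<close> to the gradient of the value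
  function.\<close>

lemma norm_grad_x_diff_le:
  assumes "(f has_derivative blinfun_apply A) (at (x, y))"
    and "(f has_derivative blinfun_apply B) (at (x', y'))"
  shows "norm (grad_x f x y - grad_x f x' y') \<le> norm (A - B)"
proof -
  let ?d = "grad_x f x y - grad_x f x' y'"
  have "inner ?d ?d = blinfun_apply (A - B) (?d, 0)"
    by (simp add: inner_diff_left inner_grad_x[OF assms(1)] inner_grad_x[OF assms(2)] blinfun.diff_left)
  also have "\<dots> \<le> norm (A - B) * norm (?d, 0::real^'b)"
    using norm_blinfun[of "A - B" "(?d, 0::real^'b)"] by simp
  finally have "norm ?d * norm ?d \<le> norm (A - B) * norm ?d"
    by (simp add: dot_square_norm power2_eq_square norm_Pair)
  then show ?thesis by (cases "?d = 0") auto
qed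

section \<open>Envelope theorem for the value function\<close>

lemma value_function_eq:
  assumes "argmin_set f Y x = {y}"
  shows "value_function f Y x = f (x, y)" "y \<in> Y" "\<And>y'. y' \<in> Y \<Longrightarrow> f (x, y) \<le> f (x, y')"
proof -
  have "y \<in> argmin_set f Y x" using assms by simp
  then show y: "y \<in> Y" and le: "\<And>y'. y' \<in> Y \<Longrightarrow> f (x, y) \<le> f (x, y')"
    by (auto simp: argmin_set_def is_arg_min_linorder)
  show "value_function f Y x = f (x, y)"
    unfolding value_function_def using y le by (intro cInf_eq_minimum) auto
qed

text \<open>Danskin's sandwich: by optimality the increment of the value function lies between
  \<open>f (z, s z) - f (x, s z)\<close> and \<open>f (z, s x) - f (x, s x)\<close>. Both have
  increment \<open>(z - x, 0)\<close>, and strict differentiability at \<open>(x, s x)\<close>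
  handles the two base points alike.\<close>

lemma value_function_has_derivative:
  fixes f :: "'a::real_normed_vector \<times> 'b::real_normed_vector \<Rightarrow> real"
  assumes der: "\<And>z. (f has_derivative blinfun_apply (f' z)) (at z)"
    and cont: "isCont f' (x, s x)"
    and U: "open U" "x \<in> U" and s: "\<And>z. z \<in> U \<Longrightarrow> argmin_set f Y z = {s z}" "isCont s x"
  shows "(value_function f Y has_derivative (\<lambda>h. blinfun_apply (f' (x, s x)) (h, 0))) (at x)"
  unfolding has_derivative_at_alt
proof (intro conjI allI impI)
  show "bounded_linear (\<lambda>h. blinfun_apply (f' (x, s x)) (h, 0))"
    using has_derivative_bounded_linear[OF has_derivative_partial_fst[OF der]] .
  fix e :: real assume "e > 0"
  then obtain d where d: "d > 0" "\<And>a b. a \<in> ball (x, s x) d \<Longrightarrow> b \<in> ball (x, s x) d \<Longrightarrow>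
       norm (f b - f a - blinfun_apply (f' (x, s x)) (b - a)) \<le> e * norm (b - a)"
    using C1_imp_strict_derivative[of UNIV "(x, s x)" f f' e] der cont by auto
  \<comment> \<open>All corners of the sandwich must enter the ball. The filter is
    \<open>nhds\<close> because the bound to be shown also ranges over \<open>z = x\<close>.\<close>
  have "((\<lambda>z. (z, s z)) \<longlongrightarrow> (x, s x)) (nhds x)" "((\<lambda>z. (x, s z)) \<longlongrightarrow> (x, s x)) (nhds x)"
      "((\<lambda>z. (z, s x)) \<longlongrightarrow> (x, s x)) (nhds x)"
    using s(2) by (auto intro!: tendsto_intros simp: continuous_at filterlim_ident isCont_def tendsto_at_iff_tendsto_nhds)
  then have "\<forall>\<^sub>F z in nhds x. (z, s z) \<in> ball (x, s x) d" "\<forall>\<^sub>F z in nhds x. (x, s z) \<in> ball (x, s x) d"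
      "\<forall>\<^sub>F z in nhds x. (z, s x) \<in> ball (x, s x) d" "\<forall>\<^sub>F z in nhds x. z \<in> U"
    using d(1) U by (auto intro!: topological_tendstoD[where S = "ball (x, s x) d"] eventually_nhds_in_open simp del: mem_ball simp: centre_in_ball)
  then have "\<forall>\<^sub>F z in nhds x. norm (value_function f Y z - value_function f Y x
      - blinfun_apply (f' (x, s x)) (z - x, 0)) \<le> e * norm (z - x)"
  proof eventually_elim
    case (elim z)
    note vz = value_function_eq[OF s(1)[OF elim(4)]] and vx = value_function_eq[OF s(1)[OF U(2)]]
    have c: "(x, s x) \<in> ball (x, s x) d" using d by simp
    have "\<bar>f (z, s x) - f (x, s x) - blinfun_apply (f' (x, s x)) (z - x, 0)\<bar> \<le> e * norm (z - x)"
      using d(2)[OF c elim(3)] by (simp add: norm_Pair)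
    moreover have "\<bar>f (z, s z) - f (x, s z) - blinfun_apply (f' (x, s x)) (z - x, 0)\<bar> \<le> e * norm (z - x)"
      using d(2)[OF elim(2) elim(1)] by (simp add: norm_Pair)
    moreover have "f (z, s z) \<le> f (z, s x)" "f (x, s x) \<le> f (x, s z)"
      using vz(2,3) vx(2,3) by auto
    ultimately show ?case by (simp add: vz(1) vx(1) abs_le_iff)
  qed
  then show "\<exists>d>0. \<forall>z. norm (z - x) < d \<longrightarrow> norm (value_function f Y z - value_function f Y x
      - blinfun_apply (f' (x, s x)) (z - x, 0)) \<le> e * norm (z - x)"
    unfolding eventually_nhds_metric dist_norm .
qed

section \<open>Coderivative of a locally single-valued Lipschitz map\<close>

text \<open>Over \<open>U\<close> the graph of \<open>\<Psi>\<close> is that of \<open>G\<close>, so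
  a regular normal near the limit can be tested along \<open>z \<mapsto> (z, G z)\<close>. The
  Lipschitz bound makes all errors multiples of \<open>norm (z - x)\<close>.\<close>

lemma coderivative_locally_single_valued:
  fixes \<Psi> :: "'a::real_inner \<Rightarrow> 'b::real_inner set"
  assumes U: "open U" "x0 \<in> U" and \<Psi>: "\<And>x. x \<in> U \<Longrightarrow> \<Psi> x = {G x}"
    and lip: "M-lipschitz_on U G" and x': "x' \<in> coderivative \<Psi> x0 (G x0) u" and e: "e > 0"
  obtains x v where "x \<in> U" "dist x x0 < e" "norm (v - x') < e"
    "\<forall>\<^sub>F z in at x. inner v (z - x) \<le> inner u (G z - G x) + e * norm (z - x)"
proof -
  obtain vs zs where lim: "vs \<longlonglongrightarrow> (x', - u)" "zs \<longlonglongrightarrow> (x0, G x0)"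
    and zs: "\<And>k::nat. zs k \<in> graph \<Psi>" and reg: "\<And>k. vs k \<in> regular_normal_cone (graph \<Psi>) (zs k)"
    using x' unfolding coderivative_def normal_cone_def by blast
  have M: "M \<ge> 0" using lip lipschitz_on_nonneg by blast
  \<comment> \<open>Of the factor \<open>1 + 2 * M\<close>, the part \<open>1 + M\<close> bounds the
    length of the graph increment and the other \<open>M\<close> is the cost of replacing
    \<open>b\<close> by \<open>- u\<close>.\<close>
  define \<eta> where "\<eta> = e / (1 + 2 * M)"
  have \<eta>: "\<eta> > 0" "\<eta> * (1 + 2 * M) = e" using e M by (auto simp: \<eta>_def)
  have x_lim: "(\<lambda>k. fst (zs k)) \<longlonglongrightarrow> x0" using tendsto_fst[OF lim(2)] by simp
  have v_lim: "(\<lambda>k. fst (vs k)) \<longlonglongrightarrow> x'" using tendsto_fst[OF lim(1)] by simp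
  have u_lim: "(\<lambda>k. snd (vs k)) \<longlonglongrightarrow> - u" using tendsto_snd[OF lim(1)] by simp
  have "\<forall>\<^sub>F k in sequentially. fst (zs k) \<in> U \<and> dist (fst (zs k)) x0 < e
      \<and> dist (fst (vs k)) x' < e \<and> dist (snd (vs k)) (- u) < \<eta>"
    by (intro eventually_conj tendstoD x_lim v_lim u_lim e \<eta>(1) topological_tendstoD[OF x_lim] U)
  then obtain k where k: "fst (zs k) \<in> U" "dist (fst (zs k)) x0 < e" "dist (fst (vs k)) x' < e"
      "dist (snd (vs k)) (- u) < \<eta>"
    using eventually_sequentially by auto
  define x v b where "x = fst (zs k)" and "v = fst (vs k)" and "b = snd (vs k)"
  have xU: "x \<in> U" using k by (simp add: x_def)
  have zk: "zs k = (x, G x)"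
    using zs[of k] \<Psi>[OF xU] unfolding graph_def x_def by (cases "zs k") auto
  have vk: "vs k = (v, b)" by (simp add: v_def b_def)
  have "isCont G x"
    using lipschitz_on_continuous_on[OF lip] U(1) xU continuous_on_eq_continuous_at by blast
  then have "((\<lambda>z. (z, G z)) \<longlongrightarrow> (x, G x)) (at x)"
    unfolding isCont_def by (intro tendsto_intros)
  moreover have "\<forall>\<^sub>F z in at x. z \<in> U" using U(1) xU by (rule eventually_at_in_open')
  then have "\<forall>\<^sub>F z in at x. (z, G z) \<in> graph \<Psi> \<and> (z, G z) \<noteq> (x, G x)"
    using eventually_neq_at_within[of x] by eventually_elim (simp add: graph_def \<Psi>)
  ultimately have "filterlim (\<lambda>z. (z, G z)) (at (x, G x) within graph \<Psi>) (at x)"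
    unfolding filterlim_at by simp
  moreover have "\<forall>\<^sub>F p in at (x, G x) within graph \<Psi>. inner (v, b) (p - (x, G x)) \<le> \<eta> * norm (p - (x, G x))"
    using reg[of k] \<eta>(1) unfolding regular_normal_cone_def zk vk by blast
  ultimately have "\<forall>\<^sub>F z in at x. inner (v, b) ((z, G z) - (x, G x)) \<le> \<eta> * norm ((z, G z) - (x, G x))"
    unfolding filterlim_iff by blast
  then have "\<forall>\<^sub>F z in at x. inner v (z - x) \<le> inner u (G z - G x) + e * norm (z - x)"
    using \<open>\<forall>\<^sub>F z in at x. z \<in> U\<close>
  proof eventually_elim
    case (elim z)
    have lipz: "norm (G z - G x) \<le> M * norm (z - x)"
      using lipschitz_onD[OF lip elim(2) xU] by (simp add: dist_norm)
    have "norm (z - x, G z - G x) \<le> norm (z - x) + M * norm (z - x)"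
      using norm_Pair_le[of "z - x" "G z - G x"] lipz by simp
    then have "\<eta> * norm (z - x, G z - G x) \<le> \<eta> * (norm (z - x) + M * norm (z - x))"
      using \<eta>(1) by (intro mult_left_mono) auto
    then have 1: "inner v (z - x) + inner b (G z - G x) \<le> \<eta> * (norm (z - x) + M * norm (z - x))"
      using elim(1) by simp
    have "inner (- b - u) (G z - G x) \<le> norm (- b - u) * norm (G z - G x)"
      by (rule norm_cauchy_schwarz)
    also have "\<dots> \<le> \<eta> * (M * norm (z - x))"
      using k(4) lipz \<eta>(1) M unfolding b_def dist_norm
      by (intro mult_mono) (auto simp: norm_minus_commute add.commute)
    finally have "inner v (z - x) \<le> inner u (G z - G x) + \<eta> * (1 + 2 * M) * norm (z - x)"
      using 1 by (simp add: inner_diff_left algebra_simps)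
    then show ?case by (simp add: \<eta>(2))
  qed
  then show thesis using that[OF xU] k by (simp add: x_def v_def dist_norm)
qed

section \<open>The inclusion for the generalized Hessian of the value function\<close>

lemma subdifferential_C1:
  assumes "sd = mordukhovich_subdifferential \<or> sd = clarke_subdifferential"
    and "open U" "x \<in> U" "\<And>z. z \<in> U \<Longrightarrow> (\<phi> has_derivative (\<lambda>h. inner (G z) h)) (at z)" "isCont G x"
  shows "sd \<phi> x = {G x}"
  using assms mordukhovich_subdifferential_C1[of U x \<phi> G] clarke_subdifferential_C1[of U x \<phi> G] by auto

text \<open>The equality for \<open>sd \<phi> xbar\<close> belongs to the conclusion because the
  abbreviated notation for the generalized Hessian presupposes a singleton subdifferential.\<close>

theorem theorem5p1:
  fixes f :: "(real^'n) \<times> (real^'m) \<Rightarrow> real"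
    and g :: "real^'m \<Rightarrow> real^'p"
    and Y :: "(real^'m) set"
    and \<phi> :: "real^'n \<Rightarrow> real"
    and S :: "real^'n \<Rightarrow> (real^'m) set"
    and s :: "real^'n \<Rightarrow> real^'m"
    and xbar :: "real^'n" and ybar :: "real^'m"
    and sd :: "(real^'n \<Rightarrow> real) \<Rightarrow> real^'n \<Rightarrow> (real^'n) set"
  assumes f_C2: "twice_continuously_differentiable f"
    and g_C2: "twice_continuously_differentiable g"
    and Y: "Y = {y. \<forall>i. g y $ i \<le> 0}"
    and phi: "\<phi> = value_function f Y"
    and S: "S = argmin_set f Y"
    and S_nonempty: "\<forall>x. S x \<noteq> {}"
    and s: "\<exists>U L. open U \<and> xbar \<in> U \<and> (\<forall>x\<in>U. S x = {s x}) \<and> L-lipschitz_on U s"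
    and ybar: "ybar = s xbar"
    and sd: "sd = mordukhovich_subdifferential \<or> sd = clarke_subdifferential"
  shows "sd \<phi> xbar = {grad_x f xbar ybar} \<and>
    (\<forall>u. generalized_hessian sd \<phi> xbar (grad_x f xbar ybar) u
      \<subseteq> (\<lambda>\<xi>. hess_xx f xbar ybar *v u + \<xi>) `
          mordukhovich_subdifferential (\<lambda>x. inner (hess_xy f xbar ybar *v u) (s x)) xbar)"
proof -
  obtain f' f'' where der1: "\<And>z. (f has_derivative blinfun_apply (f' z)) (at z)"
    and der2: "\<And>z. (f' has_derivative blinfun_apply (f'' z)) (at z)" and contf'': "continuous_on UNIV f''"
    using f_C2 unfolding twice_continuously_differentiable_def by blast
  obtain U L where U: "open U" "xbar \<in> U" and SU: "\<And>x. x \<in> U \<Longrightarrow> argmin_set f Y x = {s x}"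
    and lip: "L-lipschitz_on U s"
    using s S by blast
  have L: "L \<ge> 0" using lip lipschitz_on_nonneg by blast
  have conts: "isCont s x" if "x \<in> U" for x
    using lipschitz_on_continuous_on[OF lip] U(1) that continuous_on_eq_continuous_at by blast
  have contf': "isCont f' z" for z using der2 has_derivative_continuous by blast
  define G where "G x = grad_x f x (s x)" for x
  have derphi: "(\<phi> has_derivative (\<lambda>h. inner (G x) h)) (at x)" if "x \<in> U" for x
    using value_function_has_derivative[OF der1 contf' U(1) that SU conts[OF that]]
    by (simp add: phi G_def inner_grad_x[OF der1])
  have G_le: "norm (G z - G x) \<le> norm (f' (z, s z) - f' (x, s x))" for z x
    unfolding G_def by (rule norm_grad_x_diff_le[OF der1 der1])
  have contG: "isCont G x" if "x \<in> U" for x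
  proof -
    have "((\<lambda>z. f' (z, s z)) \<longlongrightarrow> f' (x, s x)) (at x)"
      using conts[OF that] unfolding isCont_def
      by (intro isCont_tendsto_compose[OF contf'] tendsto_intros)
    then have "((\<lambda>z. norm (f' (z, s z) - f' (x, s x))) \<longlongrightarrow> 0) (at x)"
      by (simp add: LIM_zero tendsto_norm_zero)
    then have "((\<lambda>z. G z - G x) \<longlongrightarrow> 0) (at x)"
      by (rule Lim_null_comparison[OF always_eventually, rotated]) (use G_le in auto)
    then show ?thesis unfolding isCont_def by (simp add: LIM_zero_iff)
  qed
  have sdU: "sd \<phi> x = {G x}" if "x \<in> U" for x
    using subdifferential_C1[OF sd U(1) that derphi contG[OF that]] by blast
  have Gbar: "G xbar = grad_x f xbar ybar" by (simp add: G_def ybar)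
  define z0 where "z0 = (xbar, ybar)"
  \<comment> \<open>\<open>f''\<close> stays frozen at \<open>z0\<close> while \<open>x\<close> and
    \<open>z\<close> vary; hence only the Hessian blocks at \<open>(xbar, ybar)\<close> appear in
    the result. The same estimate makes \<open>G\<close> Lipschitz.\<close>
  have strict: "\<exists>V M. open V \<and> xbar \<in> V \<and> V \<subseteq> U \<and> M-lipschitz_on V G \<and>
      (\<forall>x\<in>V. \<forall>z\<in>V. norm (f' (z, s z) - f' (x, s x) - blinfun_apply (f'' z0) (z - x, s z - s x))
         \<le> e * norm (z - x))" if e: "e > 0" for e
  proof -
    have "isCont f'' z0" using contf'' continuous_on_eq_continuous_at by blast
    \<comment> \<open>Dividing by \<open>1 + L\<close> compensates for the length of
      \<open>(z - x, s z - s x)\<close>, which is at most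
      \<open>(1 + L) * norm (z - x)\<close>.\<close>
    moreover have "e / (1 + L) > 0" using e L by simp
    ultimately obtain d where d: "d > 0" "\<And>a b. a \<in> ball z0 d \<Longrightarrow> b \<in> ball z0 d \<Longrightarrow>
       norm (f' b - f' a - blinfun_apply (f'' z0) (b - a)) \<le> e / (1 + L) * norm (b - a)"
      using C1_imp_strict_derivative[of UNIV z0 f' f'' "e / (1 + L)"] der2 by auto
    define W where "W = U \<inter> (\<lambda>x. (x, s x)) -` ball z0 d"
    have "continuous_on U (\<lambda>x. (x, s x))"
      using lipschitz_on_continuous_on[OF lip] by (intro continuous_intros)
    then have "open W" unfolding W_def using U(1) by (intro continuous_open_preimage) auto
    moreover have "xbar \<in> W" using U d(1) by (simp add: W_def z0_def ybar)
    moreover have "W \<subseteq> U" by (auto simp: W_def)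
    moreover have est: "norm (f' (z, s z) - f' (x, s x) - blinfun_apply (f'' z0) (z - x, s z - s x))
         \<le> e * norm (z - x)"
      and pair: "norm (z - x, s z - s x) \<le> (1 + L) * norm (z - x)" if "x \<in> W" "z \<in> W" for x z
    proof -
      have "norm (s z - s x) \<le> L * norm (z - x)"
        using lipschitz_onD[OF lip, of z x] that by (simp add: W_def dist_norm)
      then show p: "norm (z - x, s z - s x) \<le> (1 + L) * norm (z - x)"
        using norm_Pair_le[of "z - x" "s z - s x"] by (simp add: algebra_simps)
      have "norm (f' (z, s z) - f' (x, s x) - blinfun_apply (f'' z0) (z - x, s z - s x))
         \<le> e / (1 + L) * norm (z - x, s z - s x)"
        using d(2)[of "(x, s x)" "(z, s z)"] that by (simp add: W_def)
      also have "\<dots> \<le> e / (1 + L) * ((1 + L) * norm (z - x))"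
        using p e L by (intro mult_left_mono) auto
      also have "\<dots> = e * norm (z - x)" using L by simp
      finally show "norm (f' (z, s z) - f' (x, s x) - blinfun_apply (f'' z0) (z - x, s z - s x))
         \<le> e * norm (z - x)" .
    qed
    moreover have "(e + norm (f'' z0) * (1 + L))-lipschitz_on W G"
    proof (rule lipschitz_onI)
      fix z x assume zx: "z \<in> W" "x \<in> W"
      let ?B = "blinfun_apply (f'' z0) (z - x, s z - s x)"
      have "norm (f' (z, s z) - f' (x, s x)) \<le> norm (f' (z, s z) - f' (x, s x) - ?B) + norm ?B"
        using norm_triangle_ineq[of "f' (z, s z) - f' (x, s x) - ?B" ?B] by simp
      also have "norm ?B \<le> norm (f'' z0) * ((1 + L) * norm (z - x))"
        using norm_blinfun[of "f'' z0" "(z - x, s z - s x)"] mult_left_mono[OF pair[OF zx(2,1)] norm_ge_zero]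
        by (rule order_trans)
      finally show "dist (G z) (G x) \<le> (e + norm (f'' z0) * (1 + L)) * dist z x"
        using est[OF zx(2,1)] G_le[of z x] by (simp add: dist_norm algebra_simps)
    qed (use e L in simp)
    ultimately show ?thesis by blast
  qed
  have incl: "x' \<in> (\<lambda>\<xi>. hess_xx f xbar ybar *v u + \<xi>) `
      mordukhovich_subdifferential (\<lambda>x. inner (hess_xy f xbar ybar *v u) (s x)) xbar"
    if x': "x' \<in> generalized_hessian sd \<phi> xbar (G xbar) u" for x' u
  proof -
    let ?Hx = "hess_xx f xbar ybar *v u" and ?Hy = "hess_xy f xbar ybar *v u"
    have "x' - ?Hx \<in> mordukhovich_subdifferential (\<lambda>x. inner ?Hy (s x)) xbar"
    proof (rule mordukhovich_subgradientI_approximate[OF U])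
      show "continuous_on U (\<lambda>x. inner ?Hy (s x))"
        using lipschitz_on_continuous_on[OF lip] by (intro continuous_intros)
      fix e :: real assume e: "e > 0"
      \<comment> \<open>Two errors share \<open>e\<close>: \<open>\<eta>\<close> from the
        coderivative inequality and \<open>\<eta> * norm u\<close> from the remainder of
        \<open>f'\<close> evaluated at \<open>(u, 0)\<close>.\<close>
      define \<eta> where "\<eta> = e / (1 + norm u)"
      have nu: "1 + norm u > 0" by (simp add: add_pos_nonneg)
      have \<eta>: "\<eta> > 0" "\<eta> + \<eta> * norm u = e"
        using e nu by (auto simp: \<eta>_def add_divide_distrib[symmetric] field_simps)
      have \<eta>e: "\<eta> \<le> e" using \<eta> by (smt (verit) mult_nonneg_nonneg norm_ge_zero)
      obtain V M where V: "open V" "xbar \<in> V" "V \<subseteq> U" "M-lipschitz_on V G"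
        and est: "\<And>x z. x \<in> V \<Longrightarrow> z \<in> V \<Longrightarrow>
          norm (f' (z, s z) - f' (x, s x) - blinfun_apply (f'' z0) (z - x, s z - s x)) \<le> \<eta> * norm (z - x)"
        using strict[OF \<eta>(1)] by blast
      obtain x v where x: "x \<in> V" "dist x xbar < \<eta>" "norm (v - x') < \<eta>"
        and ev: "\<forall>\<^sub>F z in at x. inner v (z - x) \<le> inner u (G z - G x) + \<eta> * norm (z - x)"
        using coderivative_locally_single_valued[OF V(1,2) sdU V(4) x'[unfolded generalized_hessian_def] \<eta>(1)]
          V(3) by blast
      have "\<forall>\<^sub>F z in at x. z \<in> V" using V(1) x(1) by (rule eventually_at_in_open')
      with ev have "\<forall>\<^sub>F z in at x. inner (v - ?Hx) (z - x) \<le> inner ?Hy (s z) - inner ?Hy (s x) + e * norm (z - x)"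
      proof eventually_elim
        case (elim z)
        let ?R = "f' (z, s z) - f' (x, s x) - blinfun_apply (f'' z0) (z - x, s z - s x)"
        have "inner u (G z - G x) = blinfun_apply (f' (z, s z) - f' (x, s x)) (u, 0)"
          by (simp add: inner_commute[of u] inner_diff_left G_def inner_grad_x[OF der1] blinfun.diff_left)
        \<comment> \<open>The \<open>?Hx\<close> term will be moved to the left and corrects the
          slope \<open>v\<close>; the \<open>?Hy\<close> term is the increment of the scalarised
          solution map.\<close>
        also have "\<dots> = blinfun_apply ?R (u, 0) + (inner ?Hx (z - x) + inner ?Hy (s z - s x))"
          unfolding z0_def second_derivative_eq_hess[OF der1 der2, symmetric]
          by (simp add: blinfun.diff_left)
        also have "blinfun_apply ?R (u, 0) \<le> norm ?R * norm u"
          using norm_blinfun[of ?R "(u, 0)"] by (simp add: norm_Pair)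
        also have "norm ?R * norm u \<le> \<eta> * norm (z - x) * norm u"
          using est[OF x(1) elim(2)] by (intro mult_right_mono) auto
        finally have "inner v (z - x) - inner ?Hx (z - x)
            \<le> inner ?Hy (s z - s x) + (\<eta> + \<eta> * norm u) * norm (z - x)"
          using elim(1) by (simp add: algebra_simps)
        then show ?case by (simp add: \<eta>(2) inner_diff_left inner_diff_right)
      qed
      moreover have "norm ((v - ?Hx) - (x' - ?Hx)) < e" "dist x xbar < e" using x \<eta>e by simp_all
      ultimately show "\<exists>x w'. dist x xbar < e \<and> norm (w' - (x' - ?Hx)) < e \<and>
          (\<forall>\<^sub>F z in at x. inner w' (z - x) \<le> inner ?Hy (s z) - inner ?Hy (s x) + e * norm (z - x))"
        by blast
    qed
    then show ?thesis by (rule image_eqI[rotated]) simp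
  qed
  show ?thesis using sdU[OF U(2)] incl unfolding Gbar by blast
qed

end
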